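(* Let $n$ be an odd positive integer and let $r\ge 0$ be an integer such that $2^r < n$. Then $Q_n$ can be decomposed into paths of length $2^r$.
   Context: The $n$-dimensional hypercube $Q_n$ is the graph with vertex set $\{0,1\}^n$ in which two vertices $x,y$ are adjacent iff $\|x-y\|_1 = 1$. A path of length $k$ is a sequence of distinct vertices $x_1,\dots,x_{k+1}$ with $x_i x_{i+1}$ an edge for all $1\le i\le k$. A decomposition of a graph into paths of length $k$ is a collection of paths of length $k$ in the graph whose edge sets partition the edge set of the graph. *)

theory Defs
  imports Complex_Main "HOL-Library.FuncSet" "HOL-Library.Disjoint_Sets"
begin

(* A finite simple graph is given by its vertex set V and its edge set E, whose members are
   the two-element sets {x, y} of adjacent vertices. *)

definition path_edges :: "'a list \<Rightarrow> 'a set set" where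
  "path_edges xs = {{xs ! i, xs ! Suc i} |i. Suc i < length xs}"

(* The length k counts edges, so a path of length k is a list of k + 1 distinct vertices. *)
definition is_path :: "'a set \<Rightarrow> 'a set set \<Rightarrow> nat \<Rightarrow> 'a list \<Rightarrow> bool" where
  "is_path V E k xs \<longleftrightarrow>
     length xs = k + 1 \<and> distinct xs \<and> set xs \<subseteq> V \<and> path_edges xs \<subseteq> E"

(* The disjointness is that of the family of edge sets indexed by the members of P, so that
   two different members (for instance a path and its reversal) cannot share an edge. *)
definition path_decomposition :: "'a set \<Rightarrow> 'a set set \<Rightarrow> nat \<Rightarrow> 'a list set \<Rightarrow> bool" where
  "path_decomposition V E k P \<longleftrightarrow>
     (\<forall>xs\<in>P. is_path V E k xs) \<and>
     disjoint_family_on path_edges P \<and>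
     (\<Union>xs\<in>P. path_edges xs) = E"

(* Coordinates are indexed by 0, ..., n - 1; the extensional function space makes the vertices
   correspond exactly to the 0-1 vectors of length n. *)
definition hypercube_verts :: "nat \<Rightarrow> (nat \<Rightarrow> int) set" where
  "hypercube_verts n = {..<n} \<rightarrow>\<^sub>E {0, 1}"

definition l1_dist :: "nat \<Rightarrow> (nat \<Rightarrow> int) \<Rightarrow> (nat \<Rightarrow> int) \<Rightarrow> int" where
  "l1_dist n x y = (\<Sum>i<n. \<bar>x i - y i\<bar>)"

definition hypercube_edges :: "nat \<Rightarrow> (nat \<Rightarrow> int) set set" where
  "hypercube_edges n =
     {{x, y} |x y. x \<in> hypercube_verts n \<and> y \<in> hypercube_verts n \<and> l1_dist n x y = 1}"

end

(*
  Let k = 2^r with r >= 1 and n = 2t + 1. Pairing the first 2t directions makes each of the two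
  layers of Q_n over the last coordinate a torus (C_4)^t, so its edges are oriented by t
  permutations, the rotations of the factors. Exchanging these permutations among each other in
  dependence on the vertex gives another such system in which one permutation has only cycles of
  length divisible by 4^r and the permutations beyond the first r are still plain rotations.

  Every vertex x of the lower layer starts a path of length k: apply k/2 - 1 of the permutations of
  the lower layer once each, cross to the upper layer, and apply k/2 of its permutations once each.
  As the maps are permutations, these paths cover all edges between the layers and, exactly once,
  all edges of the permutations used. They do not revisit vertices since mixed permutations are
  interleaved with plain rotations in pairwise distinct planes. The unused permutations of a layer,
  namely the one with long cycles and some rotations, are applied cyclically; this gives closed
  walks of length divisible by k, which are cut into paths of length k.
*)

theory Submission
  imports Defs "HOL-Combinatorics.Permutations" "HOL-Library.Multiset"
begin

section \<open>Directed paths\<close>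

definition arcs :: "'a list \<Rightarrow> ('a \<times> 'a) set" where
  "arcs xs = set (zip xs (tl xs))"

text \<open>Directed counterpart of \<open>path_decomposition\<close>, suited to permutations, which
  orient the edges they use. No vertex set is recorded: for paths with at least one arc it is
  recovered from the endpoints of \<open>A\<close>.\<close>

definition arc_decomposition :: "('a \<times> 'a) set \<Rightarrow> nat \<Rightarrow> 'a list set \<Rightarrow> bool" where
  "arc_decomposition A k P \<longleftrightarrow>
     (\<forall>xs\<in>P. length xs = k + 1 \<and> distinct xs) \<and>
     disjoint_family_on arcs P \<and> (\<Union>xs\<in>P. arcs xs) = A"

lemma arcs_simps [simp]:
  "arcs [] = {}" "arcs [x] = {}" "arcs (x # y # zs) = insert (x, y) (arcs (y # zs))"
  by (simp_all add: arcs_def)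

lemma arcs_Cons: "ys \<noteq> [] \<Longrightarrow> arcs (x # ys) = insert (x, hd ys) (arcs ys)"
  by (cases ys) auto

lemma arcs_append:
  "xs \<noteq> [] \<Longrightarrow> ys \<noteq> [] \<Longrightarrow> arcs (xs @ ys) = arcs xs \<union> {(last xs, hd ys)} \<union> arcs ys"
proof (induction xs)
  case (Cons x xs)
  then show ?case
    by (cases xs; cases ys) auto
qed simp

lemma set_subset_arcs: "length xs \<ge> 2 \<Longrightarrow> set xs \<subseteq> fst ` arcs xs \<union> snd ` arcs xs"
proof (induction xs)
  case (Cons x xs)
  then show ?case
  proof (cases xs)
    case (Cons y ys)
    then show ?thesis using Cons.IH by (cases ys) auto
  qed simp
qed simp

lemma path_edges_arcs: "path_edges xs = (\<lambda>(y, z). {y, z}) ` arcs xs"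
proof -
  have "path_edges xs = (\<lambda>i. {xs ! i, xs ! Suc i}) ` {..<length xs - 1}"
    by (auto simp: path_edges_def)
  moreover have "arcs xs = (\<lambda>i. (xs ! i, xs ! Suc i)) ` {..<length xs - 1}"
    unfolding arcs_def set_zip by (auto simp: nth_tl)
  ultimately show ?thesis by (simp add: image_image)
qed

lemma arc_decomposition_Un:
  assumes "arc_decomposition A k P" "arc_decomposition B k Q" "A \<inter> B = {}"
  shows "arc_decomposition (A \<union> B) k (P \<union> Q)"
proof -
  have P: "arcs p \<subseteq> A" if "p \<in> P" for p using assms(1) that by (auto simp: arc_decomposition_def)
  have Q: "arcs p \<subseteq> B" if "p \<in> Q" for p using assms(2) that by (auto simp: arc_decomposition_def)
  have "arcs p \<inter> arcs q = {}" if "p \<in> P \<union> Q" "q \<in> P \<union> Q" "p \<noteq> q" for p q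
  proof -
    have "arcs p \<inter> arcs q = {}" if "p \<in> P" "q \<in> P"
      using assms(1) that \<open>p \<noteq> q\<close> by (simp add: arc_decomposition_def disjoint_family_on_def)
    moreover have "arcs p \<inter> arcs q = {}" if "p \<in> Q" "q \<in> Q"
      using assms(2) that \<open>p \<noteq> q\<close> by (simp add: arc_decomposition_def disjoint_family_on_def)
    moreover have "arcs p \<inter> arcs q = {}" if "p \<in> P" "q \<in> Q"
      using P[OF that(1)] Q[OF that(2)] assms(3) by blast
    moreover have "arcs p \<inter> arcs q = {}" if "p \<in> Q" "q \<in> P"
      using P[OF that(2)] Q[OF that(1)] assms(3) by blast
    ultimately show ?thesis using that by blast
  qed
  then show ?thesis
    using assms unfolding arc_decomposition_def disjoint_family_on_def by (simp add: ball_Un)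
qed

text \<open>\<open>g\<close> may identify indices: different members of the image come from
  different indices, so disjointness over \<open>X\<close> suffices.\<close>

lemma arc_decomposition_image:
  assumes "\<And>x. x \<in> X \<Longrightarrow> length (g x) = k + 1 \<and> distinct (g x)"
    and "disjoint_family_on (\<lambda>x. arcs (g x)) X"
    and "(\<Union>x\<in>X. arcs (g x)) = A"
  shows "arc_decomposition A k (g ` X)"
  using assms unfolding arc_decomposition_def disjoint_family_on_def by (simp add: image_iff) metis

text \<open>Injectivity says that every edge is oriented only once, so disjointness of arcs passes
  to edges. Since \<open>k \<ge> 1\<close>, every vertex of a path is an endpoint of one of its arcs
  and thus lies in \<open>V\<close>.\<close>

lemma path_decomposition_of_arcs:
  assumes P: "arc_decomposition A k P" and "k \<ge> 1" and "A \<subseteq> V \<times> V"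
    and inj: "inj_on (\<lambda>(y, z). {y, z}) A"
  shows "path_decomposition V ((\<lambda>(y, z). {y, z}) ` A) k P"
proof -
  have sub: "arcs p \<subseteq> A" if "p \<in> P" for p using P that by (auto simp: arc_decomposition_def)
  have "set p \<subseteq> V" if "p \<in> P" for p
  proof -
    have "length p \<ge> 2" using P that \<open>k \<ge> 1\<close> by (auto simp: arc_decomposition_def)
    from set_subset_arcs[OF this] sub[OF that] \<open>A \<subseteq> V \<times> V\<close> show ?thesis by force
  qed
  moreover have "path_edges p \<inter> path_edges q = {}" if "p \<in> P" "q \<in> P" "p \<noteq> q" for p q
    unfolding path_edges_arcs
    using inj_on_image_Int[OF inj sub[OF that(1)] sub[OF that(2)]] P that
    by (auto simp: arc_decomposition_def disjoint_family_on_def)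
  ultimately show ?thesis
    using P sub unfolding path_decomposition_def is_path_def disjoint_family_on_def
    by (auto simp: path_edges_arcs arc_decomposition_def)
qed

section \<open>Walks along families of permutations\<close>

fun trace :: "('i \<Rightarrow> 'a \<Rightarrow> 'a) \<Rightarrow> 'a \<Rightarrow> 'i list \<Rightarrow> 'a list" where
  "trace f x [] = [x]"
| "trace f x (i # is) = x # trace f (f i x) is"

text \<open>Arcs recorded as a start vertex with an index, so that walks can be compared before it
  is known that different indices send a vertex to different places.\<close>

fun steps :: "('i \<Rightarrow> 'a \<Rightarrow> 'a) \<Rightarrow> 'a \<Rightarrow> 'i list \<Rightarrow> ('a \<times> 'i) set" where
  "steps f x [] = {}"
| "steps f x (i # is) = insert (x, i) (steps f (f i x) is)"

lemma trace_not_Nil [simp]: "trace f x ws \<noteq> []"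
  by (cases ws) auto

lemma hd_trace [simp]: "hd (trace f x ws) = x"
  by (cases ws) auto

lemma last_trace [simp]: "last (trace f x ws) = fold f ws x"
  by (induction ws arbitrary: x) auto

lemma length_trace [simp]: "length (trace f x ws) = Suc (length ws)"
  by (induction ws arbitrary: x) auto

lemma arcs_trace: "arcs (trace f x ws) = (\<lambda>(y, i). (y, f i y)) ` steps f x ws"
  by (induction ws arbitrary: x) (simp_all add: arcs_Cons)

lemma set_trace: "set (trace f x ws) = {fold f u x |u v. ws = u @ v}"
proof (induction ws arbitrary: x)
  case (Cons i ws)
  show ?case
  proof (intro set_eqI iffI)
    fix y assume "y \<in> set (trace f x (i # ws))"
    then consider "y = x" | u v where "ws = u @ v" "y = fold f u (f i x)"
      using Cons by auto
    then show "y \<in> {fold f u x |u v. i # ws = u @ v}"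
    proof cases
      case 1
      then have "y = fold f [] x \<and> i # ws = [] @ (i # ws)" by simp
      then show ?thesis by blast
    next
      case 2
      then have "y = fold f (i # u) x \<and> i # ws = (i # u) @ v" by simp
      then show ?thesis by blast
    qed
  next
    fix y assume "y \<in> {fold f u x |u v. i # ws = u @ v}"
    then show "y \<in> set (trace f x (i # ws))"
      using Cons by (auto simp: Cons_eq_append_conv)
  qed
qed auto

text \<open>A repeated vertex would mean that a nonempty contiguous block of the word maps some
  vertex to itself.\<close>

lemma distinct_trace:
  assumes "\<And>u v w y. ws = u @ v @ w \<Longrightarrow> v \<noteq> [] \<Longrightarrow> fold f v y \<noteq> y"
  shows "distinct (trace f x ws)"
  using assms
proof (induction ws arbitrary: x)
  case (Cons i ws)
  have "x \<noteq> fold f u (f i x)" if "ws = u @ v" for u v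
    using Cons.prems[of "[]" "i # u" v x] that by auto
  then have "x \<notin> set (trace f (f i x) ws)"
    unfolding set_trace by blast
  moreover have "distinct (trace f (f i x) ws)"
  proof (rule Cons.IH)
    fix u v w y assume "ws = u @ v @ w" "v \<noteq> []"
    then show "fold f v y \<noteq> y" using Cons.prems[of "i # u" v w y] by simp
  qed
  ultimately show ?case by simp
qed simp

lemma bij_betw_fold:
  assumes "\<And>i. i \<in> set ws \<Longrightarrow> bij_betw (f i) U U"
  shows "bij_betw (fold f ws) U U"
  using assms
proof (induction ws)
  case (Cons i ws)
  then have "bij_betw (fold f ws \<circ> f i) U U"
    by (intro bij_betw_trans[of "f i" U U]) auto
  then show ?case by (simp add: comp_def)
qed (simp add: id_def[symmetric])

lemma set_trace_subset:
  assumes "\<And>i. i \<in> set ws \<Longrightarrow> f i ` U \<subseteq> U" "x \<in> U"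
  shows "set (trace f x ws) \<subseteq> U"
  using assms by (induction ws arbitrary: x) auto

lemma steps_subset:
  assumes "\<And>i. i \<in> set ws \<Longrightarrow> f i ` U \<subseteq> U" "x \<in> U"
  shows "steps f x ws \<subseteq> U \<times> set ws"
  using assms
proof (induction ws arbitrary: x)
  case (Cons i ws)
  have "f i x \<in> U" using Cons.prems by auto
  then have "steps f (f i x) ws \<subseteq> U \<times> set ws" using Cons by auto
  then show ?case using Cons.prems by auto
qed simp

text \<open>After the first letter the walks again start from all of \<open>U\<close>, because every
  map is onto.\<close>

lemma UN_steps:
  assumes "\<And>i. i \<in> set ws \<Longrightarrow> f i ` U = U"
  shows "(\<Union>x\<in>U. steps f x ws) = U \<times> set ws"
  using assms
proof (induction ws)
  case (Cons i ws)
  have "(\<Union>x\<in>U. steps f (f i x) ws) = (\<Union>y\<in>f i ` U. steps f y ws)" by simp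
  also have "\<dots> = U \<times> set ws" using Cons by auto
  finally show ?case by auto
qed simp

text \<open>The index of a step fixes its place in the repetition-free word, and undoing the
  bijections before that place recovers the start of the walk.\<close>

lemma disjoint_steps:
  assumes "\<And>i. i \<in> set ws \<Longrightarrow> bij_betw (f i) U U" "distinct ws"
  shows "disjoint_family_on (\<lambda>x. steps f x ws) U"
proof -
  have "x = y" if "e \<in> steps f x ws" "e \<in> steps f y ws" "x \<in> U" "y \<in> U" for e x y
    using that assms
  proof (induction ws arbitrary: x y)
    case (Cons i ws)
    have im: "f j ` U \<subseteq> U" if "j \<in> set ws" for j
      using Cons.prems(5)[of j] that by (auto simp: bij_betw_def)
    have "bij_betw (f i) U U" using Cons.prems(5) by simp
    then have U: "f i x \<in> U" "f i y \<in> U" and inj: "inj_on (f i) U"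
      using Cons.prems(3,4) by (auto simp: bij_betw_def)
    have sub: "steps f (f i x) ws \<subseteq> U \<times> set ws" "steps f (f i y) ws \<subseteq> U \<times> set ws"
      using steps_subset im U by metis+
    show ?case
    proof (cases "snd e = i")
      \<comment> \<open>As \<open>i\<close> does not recur in \<open>ws\<close>, the step is the
        first one of both walks, so its vertex is both \<open>x\<close> and
        \<open>y\<close>.\<close>
      case True
      then show ?thesis using Cons.prems(1,2,6) sub by (cases e) auto
    next
      case False
      then have "f i x = f i y"
        using Cons.IH[of "f i x" "f i y"] Cons.prems U by auto
      then show ?thesis using inj Cons.prems(3,4) by (auto dest: inj_onD)
    qed
  qed simp
  then show ?thesis by (force simp: disjoint_family_on_def)
qed


section \<open>Permutations of the even-dimensional cube\<close>

definition flip :: "nat \<Rightarrow> (nat \<Rightarrow> int) \<Rightarrow> nat \<Rightarrow> int" where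
  "flip j x = x(j := if x j = 0 then 1 else 0)"

text \<open>Coordinates \<open>2 p\<close> and \<open>2 p + 1\<close> span the 4-cycle 00, 10, 11, 01,
  on which \<open>rot p\<close> is the rotation and \<open>angle p\<close> the position.\<close>

definition rot :: "nat \<Rightarrow> (nat \<Rightarrow> int) \<Rightarrow> nat \<Rightarrow> int" where
  "rot p x = (if (x (2 * p) = 0) = (x (2 * p + 1) = 0) then flip (2 * p) x else flip (2 * p + 1) x)"

definition angle :: "nat \<Rightarrow> (nat \<Rightarrow> int) \<Rightarrow> nat" where
  "angle p x = (if x (2 * p) = 0 then (if x (2 * p + 1) = 0 then 0 else 3)
                else (if x (2 * p + 1) = 0 then 1 else 2))"

lemma angle_less: "angle p x < 4"
  by (simp add: angle_def)

lemma angle_rot: "angle p (rot q x) = (if p = q then (angle p x + 1) mod 4 else angle p x)"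
proof -
  have "2 * p \<noteq> Suc (2 * q)" "Suc (2 * p) \<noteq> 2 * q" by presburger+
  then show ?thesis by (auto simp: angle_def rot_def flip_def)
qed

text \<open>In the torus formed by the cycles of \<open>rho s 0\<close>, whose position is \<open>clock s\<close>, and the
  4-cycles of \<open>rot (s + 1)\<close>, the two rotations are exchanged wherever the sum of the positions
  is not 3 modulo 4. This turns \<open>rho s 0\<close> into a permutation with cycles four times as long.\<close>

primrec clock :: "nat \<Rightarrow> (nat \<Rightarrow> int) \<Rightarrow> nat" where
  "clock 0 x = angle 0 x"
| "clock (Suc s) x = 4 * clock s x + (clock s x + angle (Suc s) x) mod 4"

primrec rho :: "nat \<Rightarrow> nat \<Rightarrow> (nat \<Rightarrow> int) \<Rightarrow> nat \<Rightarrow> int" where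
  "rho 0 i x = rot i x"
| "rho (Suc s) i x =
     (if (clock s x + angle (Suc s) x) mod 4 = 3 then rho s i x
      else rho s (transpose 0 (Suc s) i) x)"

lemma rho_large: "s < p \<Longrightarrow> rho s p = rot p"
  by (induction s) (auto simp: fun_eq_iff transpose_def)

lemma rho_0_Suc:
  "rho (Suc s) 0 x =
     (if (clock s x + angle (Suc s) x) mod 4 = 3 then rho s 0 x else rot (Suc s) x)"
  by (simp add: rho_large)

lemma rho_Suc_Suc:
  "rho (Suc s) (Suc s) x =
     (if (clock s x + angle (Suc s) x) mod 4 = 3 then rot (Suc s) x else rho s 0 x)"
  by (simp add: rho_large)

lemma rho_Suc_other: "i \<noteq> 0 \<Longrightarrow> i \<noteq> Suc s \<Longrightarrow> rho (Suc s) i = rho s i"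
  by (auto simp: fun_eq_iff transpose_def)

text \<open>The switching up to stage \<open>s\<close> only permutes indices at most
  \<open>s\<close>, so plane \<open>p\<close> is turned by the index \<open>p\<close> and by no
  other.\<close>

lemma angle_rho:
  "s < p \<Longrightarrow> angle p (rho s i x) = (if i = p then (angle p x + 1) mod 4 else angle p x)"
  by (induction s arbitrary: i) (auto simp: angle_rot transpose_def)

section \<open>Arithmetic of the clock\<close>

lemma clock_less: "clock s x < 4 ^ Suc s"
proof (induction s)
  case (Suc s)
  have "(clock s x + angle (Suc s) x) mod 4 < 4" by simp
  then show ?case using Suc by simp
qed (simp add: angle_less)

lemma clock_rot: "s < p \<Longrightarrow> clock s (rot p x) = clock s x"
  by (induction s) (auto simp: angle_rot)

text \<open>The clock is an odometer in base 4 whose last digit governs the switch. Below 3,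
  \<open>rot (Suc s)\<close> is applied and raises only this digit; at 3, \<open>rho s 0\<close>
  advances \<open>clock s\<close> and the digit wraps to 0. Hence all cycles of
  \<open>rho s 0\<close> have length divisible by \<open>4 ^ Suc s\<close>.\<close>

lemma clock_rho_0: "clock s (rho s 0 x) = (clock s x + 1) mod 4 ^ Suc s"
proof (induction s)
  case 0
  then show ?case by (simp add: angle_rot)
next
  case (Suc s)
  let ?c = "clock s x" and ?h = "angle (Suc s) x"
  have c: "?c < 4 ^ Suc s" by (rule clock_less)
  have *: "(4 :: nat) dvd 4 ^ Suc s" by simp
  show ?case
  proof (cases "(?c + ?h) mod 4 = 3")
    case True
    \<comment> \<open>The wrap-around of \<open>clock s\<close> at \<open>4 ^ Suc s\<close> is
      invisible modulo 4, so the digit moves from 3 to 0 in every case.\<close>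
    have "((?c + 1) mod 4 ^ Suc s + ?h) mod 4 = ((?c + 1) mod 4 ^ Suc s mod 4 + ?h) mod 4"
      by (simp only: mod_add_left_eq)
    also have "\<dots> = ((?c + ?h) mod 4 + 1) mod 4"
      unfolding mod_mod_cancel[OF *] by (simp add: mod_simps add_ac)
    also have "\<dots> = 0" using True by simp
    finally have "clock (Suc s) (rho (Suc s) 0 x) = 4 * ((?c + 1) mod 4 ^ Suc s)"
      using True Suc by (simp add: angle_rho)
    also have "\<dots> = (4 * (?c + 1)) mod 4 ^ Suc (Suc s)"
      by (simp only: mult_mod_right power_Suc)
    finally show ?thesis using True by simp
  next
    case False
    then have "(?c + ?h) mod 4 < 3" using mod_less_divisor[of 4 "?c + ?h"] by linarith
    moreover from this have "(?c + (?h + 1) mod 4) mod 4 = (?c + ?h) mod 4 + 1"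
      using mod_add_right_eq[of ?c "?h + 1" 4] mod_Suc[of "?c + ?h" 4] by simp
    moreover have "4 * ?c + 4 \<le> 4 ^ Suc (Suc s)" using c by simp
    ultimately show ?thesis
      using False by (simp add: rho_large clock_rot angle_rot del: power_Suc)
  qed
qed

section \<open>Outgoing arcs at a fixed vertex\<close>

lemma rho_eq_rot: "i < t \<Longrightarrow> s < t \<Longrightarrow> \<exists>p<t. rho s i x = rot p x"
proof (induction s arbitrary: i)
  case (Suc s)
  have "transpose 0 (Suc s) i < t" using Suc.prems by (auto simp: transpose_def)
  then show ?case using Suc.IH[of i] Suc.IH[of "transpose 0 (Suc s) i"] Suc.prems by auto
qed auto

text \<open>At a fixed vertex each stage either keeps the indexing or composes it with a
  transposition of \<open>{..<t}\<close>, so the set of images stays that of the plain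
  rotations.\<close>

lemma rho_image: "s < t \<Longrightarrow> (\<lambda>i. rho s i x) ` {..<t} = (\<lambda>p. rot p x) ` {..<t}"
proof (induction s)
  case (Suc s)
  let ?g = "transpose 0 (Suc s)"
  have "?g permutes {..<t}"
    using Suc.prems by (intro permutes_swap_id) auto
  then have "?g ` {..<t} = {..<t}" by (rule permutes_image)
  then have "(\<lambda>i. rho s (?g i) x) ` {..<t} = (\<lambda>i. rho s i x) ` {..<t}"
    using image_image[of "\<lambda>i. rho s i x" ?g "{..<t}"] by simp
  then show ?case using Suc by auto
qed simp

lemma rot_inject: "rot p x = rot q x \<longleftrightarrow> p = q"
proof -
  have "(angle p x + 1) mod 4 \<noteq> angle p x"
    by (simp add: angle_def)
  then have "angle p (rot p x) \<noteq> angle p (rot q x)" if "p \<noteq> q"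
    using that by (simp add: angle_rot)
  then show ?thesis by metis
qed

text \<open>The \<open>t\<close> indices reach the \<open>t\<close> distinct images under the
  rotations, so counting rules out coincidences.\<close>

lemma rho_inject:
  assumes "i < t" "j < t" "s < t"
  shows "rho s i x = rho s j x \<longleftrightarrow> i = j"
proof -
  have "inj_on (\<lambda>i. rho s i x) {..<t}"
    by (rule eq_card_imp_inj_on)
      (simp_all add: rho_image[OF \<open>s < t\<close>] card_image inj_on_def rot_inject)
  then show ?thesis using assms by (auto dest: inj_onD)
qed

lemma rot_neq: "rot p x \<noteq> x"
proof -
  have "(angle p x + 1) mod 4 \<noteq> angle p x"
    by (simp add: angle_def)
  then have "angle p (rot p x) \<noteq> angle p x"
    by (simp add: angle_rot)
  then show ?thesis by metis
qed

text \<open>In plane \<open>p\<close> the position advances by 1 or 2, never by a multiple of 4.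
  Hence rotations never orient an edge in both directions.\<close>

lemma rot_rot_neq: "rot p (rot q x) \<noteq> x"
proof -
  have "(angle p x + 1) mod 4 \<noteq> angle p x" "(angle p x + 2) mod 4 \<noteq> angle p x"
    using angle_less[of p x] by (simp_all add: angle_def)
  then have "angle p (rot p (rot q x)) \<noteq> angle p x"
    by (auto simp: angle_rot mod_simps)
  then show ?thesis by metis
qed

lemma rho_neq: "rho s i x \<noteq> x"
proof -
  have "i < Suc (max i s)" "s < Suc (max i s)" by simp_all
  from rho_eq_rot[OF this, of x] show ?thesis using rot_neq by (elim exE conjE) simp
qed

text \<open>Both maps raise \<open>v\<close> by 1, so the image determines \<open>v x\<close> and
  thereby which of the two maps was applied.\<close>

lemma inj_on_switch:
  fixes v :: "'a \<Rightarrow> nat"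
  assumes "inj_on f U" "inj_on g U"
    and "\<And>x. v (f x) = (v x + 1) mod 4" "\<And>x. v (g x) = (v x + 1) mod 4" "\<And>x. v x < 4"
  shows "inj_on (\<lambda>x. if v x = 3 then f x else g x) U"
proof (rule inj_onI)
  fix x y assume *: "x \<in> U" "y \<in> U" "(if v x = 3 then f x else g x) = (if v y = 3 then f y else g y)"
  have "v (if v z = 3 then f z else g z) = (v z + 1) mod 4" for z
    by (simp add: assms(3,4))
  from this[of x] this[of y] have "(v x + 1) mod 4 = (v y + 1) mod 4"
    unfolding *(3) by simp
  then have "v x = v y" using assms(5)[of x] assms(5)[of y] by (simp add: mod_Suc split: if_splits)
  then show "x = y" using * assms(1,2) by (auto dest: inj_onD split: if_splits)
qed

text \<open>Both \<open>rho s 0\<close> and \<open>rot (Suc s)\<close> raise the residue that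
  governs the switch by 1, so the new permutations 0 and \<open>Suc s\<close> are instances of
  \<open>inj_on_switch\<close>, with the two maps in either order.\<close>

lemma inj_on_rho:
  assumes "\<And>p. p < t \<Longrightarrow> inj_on (rot p) U" "s < t" "i < t"
  shows "inj_on (rho s i) U"
  using assms(2,3)
proof (induction s arbitrary: i)
  case 0
  have "rho 0 i = rot i" by (simp add: fun_eq_iff)
  then show ?case using assms(1) 0 by simp
next
  case (Suc s)
  let ?v = "\<lambda>x. (clock s x + angle (Suc s) x) mod 4"
  have *: "(4 :: nat) dvd 4 ^ Suc s" by simp
  have v: "?v (rho s 0 x) = (?v x + 1) mod 4" for x
  proof -
    have "?v (rho s 0 x) = ((clock s x + 1) mod 4 ^ Suc s mod 4 + angle (Suc s) x) mod 4"
      by (simp only: mod_add_left_eq clock_rho_0 angle_rho lessI) simp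
    then show ?thesis unfolding mod_mod_cancel[OF *] by (simp add: mod_simps)
  qed
  have v': "?v (rot (Suc s) x) = (?v x + 1) mod 4" for x
    by (simp add: clock_rot angle_rot mod_simps)
  have inj: "inj_on (rho s 0) U" "inj_on (rot (Suc s)) U"
    using Suc assms(1) by auto
  consider "i = 0" | "i = Suc s" | "i \<noteq> 0" "i \<noteq> Suc s" by blast
  then show ?case
  proof cases
    case 1
    then show ?thesis
      using inj_on_switch[OF inj, of ?v, OF v v']
      by (simp only: rho_0_Suc[abs_def] mod_less_divisor zero_less_numeral)
  next
    case 2
    then show ?thesis
      using inj_on_switch[OF inj(2,1), of ?v, OF v' v]
      by (simp only: rho_Suc_Suc[abs_def] mod_less_divisor zero_less_numeral)
  next
    case 3
    then show ?thesis using Suc by (simp add: rho_Suc_other)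
  qed
qed

lemma bij_betw_rho:
  assumes "\<And>p. p < t \<Longrightarrow> inj_on (rot p) U" "\<And>p. p < t \<Longrightarrow> rot p ` U \<subseteq> U" "finite U"
    and "s < t" "i < t"
  shows "bij_betw (rho s i) U U"
proof -
  have "rho s i ` U \<subseteq> U"
  proof
    fix y assume "y \<in> rho s i ` U"
    then obtain x where "x \<in> U" "y = rho s i x" by blast
    moreover obtain p where "p < t" "rho s i x = rot p x" using rho_eq_rot assms(4,5) by metis
    ultimately show "y \<in> U" using assms(2) by auto
  qed
  then show ?thesis
    using inj_on_rho[OF assms(1,4,5)] \<open>finite U\<close> by (auto simp: bij_betw_def endo_inj_surj)
qed

section \<open>Decomposing one layer\<close>

lemma count_list_distinct: "distinct v \<Longrightarrow> p \<in> set v \<Longrightarrow> count_list v p = 1"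
  by (induction v) auto

lemma angle_fold_rho:
  "s < p \<Longrightarrow> angle p (fold (rho s) v x) = (angle p x + count_list v p) mod 4"
  by (induction v arbitrary: x) (auto simp: angle_rho mod_simps angle_less)

text \<open>The net effect in plane \<open>p\<close> is a single quarter turn.\<close>

lemma fold_rho_neq_once:
  assumes "s < p" "count_list v p = 1"
  shows "fold (rho s) v x \<noteq> x"
proof -
  have "(angle p x + 1) mod 4 \<noteq> angle p x"
    using angle_less[of p x] by presburger
  then show ?thesis using angle_fold_rho[OF assms(1), of v x] assms(2) by metis
qed

text \<open>Index 0 advances the clock by 1, and rotations beyond \<open>s\<close> turn planes that
  the clock does not read. Indices from 1 to \<open>s\<close> are excluded because they may change
  it in other ways.\<close>

lemma clock_fold_rho:
  assumes "set v \<subseteq> insert 0 {s<..}"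
  shows "clock s (fold (rho s) v x) = (clock s x + count_list v 0) mod 4 ^ Suc s"
  using assms
proof (induction v arbitrary: x)
  case Nil
  then show ?case using clock_less[of s x] by simp
next
  case (Cons i v)
  then consider "i = 0" | "i \<noteq> 0" "s < i" by auto
  then show ?case
  proof cases
    case 1
    have "clock s (fold (rho s) v (rho s 0 x)) =
        ((clock s x + 1) mod 4 ^ Suc s + count_list v 0) mod 4 ^ Suc s"
      using Cons.IH[of "rho s 0 x"] Cons.prems by (simp only: clock_rho_0) simp
    also have "\<dots> = (clock s x + 1 + count_list v 0) mod 4 ^ Suc s"
      by (rule mod_add_left_eq)
    finally show ?thesis using 1 by (simp add: add_ac)
  next
    case 2
    then show ?thesis
      using Cons.IH[of "rho s i x"] Cons.prems by (simp add: rho_large clock_rot)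
  qed
qed

text \<open>A block of two or more letters contains an index beyond \<open>s\<close>, exactly once,
  and so cannot close up; a single letter has no fixed points.\<close>

lemma distinct_trace_rho:
  assumes "distinct ws" "successively (\<lambda>i j. s < i \<or> s < j) ws"
  shows "distinct (trace (rho s) x ws)"
proof (rule distinct_trace)
  fix u v w y assume ws: "ws = u @ v @ w" and "v \<noteq> []"
  then have v: "distinct v" "successively (\<lambda>i j. s < i \<or> s < j) v"
    using assms by (auto simp: successively_append_iff)
  show "fold (rho s) v y \<noteq> y"
  proof (cases "\<exists>p\<in>set v. s < p")
    case True
    then obtain p where "p \<in> set v" "s < p" by blast
    then show ?thesis using v(1) by (intro fold_rho_neq_once) (auto simp: count_list_distinct)
  next
    case False
    then obtain i where "v = [i]" using \<open>v \<noteq> []\<close> v(2) by (cases v rule: remdups_adj.cases) auto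
    then show ?thesis by (simp add: rho_neq)
  qed
qed

lemma arcs_trace_rho:
  assumes "\<And>i. i < t \<Longrightarrow> bij_betw (rho s i) U U" "s < t" "set ws \<subseteq> {..<t}" "distinct ws"
  shows "disjoint_family_on (\<lambda>x. arcs (trace (rho s) x ws)) U"
    and "(\<Union>x\<in>U. arcs (trace (rho s) x ws)) = (\<lambda>(x, i). (x, rho s i x)) ` (U \<times> set ws)"
proof -
  have bij: "bij_betw (rho s i) U U" if "i \<in> set ws" for i using assms(1,3) that by auto
  have steps: "steps (rho s) x ws \<subseteq> U \<times> set ws" if "x \<in> U" for x
    using steps_subset[of ws "rho s" U x] bij that by (auto simp: bij_betw_def)
  \<comment> \<open>The index can be read off the arc, so statements about \<open>steps\<close>
    carry over to \<open>arcs\<close>.\<close>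
  have inj: "inj_on (\<lambda>(x, i). (x, rho s i x)) (U \<times> set ws)"
    using assms(3) rho_inject[OF _ _ \<open>s < t\<close>] by (auto simp: inj_on_def subset_iff)
  show "disjoint_family_on (\<lambda>x. arcs (trace (rho s) x ws)) U"
    unfolding arcs_trace disjoint_family_on_def
  proof (intro ballI impI)
    fix x y assume *: "x \<in> U" "y \<in> U" "x \<noteq> y"
    then have "steps (rho s) x ws \<inter> steps (rho s) y ws = {}"
      using disjoint_steps[OF bij assms(4)] by (auto simp: disjoint_family_on_def)
    then show "(\<lambda>(y, i). (y, rho s i y)) ` steps (rho s) x ws
        \<inter> (\<lambda>(y, i). (y, rho s i y)) ` steps (rho s) y ws = {}"
      using inj_on_image_Int[OF inj steps steps, OF *(1,2)] by simp
  qed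
  have "(\<Union>x\<in>U. steps (rho s) x ws) = U \<times> set ws"
    using UN_steps[of ws "rho s" U] bij by (auto simp: bij_betw_def)
  then show "(\<Union>x\<in>U. arcs (trace (rho s) x ws)) = (\<lambda>(x, i). (x, rho s i x)) ` (U \<times> set ws)"
    unfolding arcs_trace by (metis image_UN)
qed

text \<open>Segments start where \<tau> vanishes modulo \<open>k\<close>. The point \<open>j\<close>
  steps into a segment has residue \<open>j\<close>, which determines its place in the segment and,
  by injectivity, the start.\<close>

lemma orbit_segments:
  assumes bij: "bij_betw \<Phi> S S" and \<tau>: "\<And>x. x \<in> S \<Longrightarrow> \<tau> (\<Phi> x) mod k = (\<tau> x + 1) mod (k :: nat)"
    and "k > 0"
  defines "S0 \<equiv> {x \<in> S. \<tau> x mod k = 0}"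
  shows "disjoint_family_on (\<lambda>x. (\<lambda>j. (\<Phi> ^^ j) x) ` {..<k}) S0"
    and "(\<Union>x\<in>S0. (\<lambda>j. (\<Phi> ^^ j) x) ` {..<k}) = S"
proof -
  have bijn: "bij_betw (\<Phi> ^^ j) S S" for j
    using bij by (rule bij_betw_funpow)
  have \<tau>n: "\<tau> ((\<Phi> ^^ j) x) mod k = (\<tau> x + j) mod k" if "x \<in> S" for x j
  proof (induction j)
    case (Suc j)
    have "(\<Phi> ^^ j) x \<in> S" using bijn that by (auto simp: bij_betw_def)
    then have "\<tau> ((\<Phi> ^^ Suc j) x) mod k = (\<tau> ((\<Phi> ^^ j) x) mod k + 1) mod k"
      using \<tau> by (simp add: mod_simps)
    then show ?case using Suc by (simp add: mod_simps)
  qed simp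
  have \<tau>0: "\<tau> ((\<Phi> ^^ j) x) mod k = j" if "x \<in> S0" "j < k" for x j
  proof -
    have "(\<tau> x + j) mod k = (\<tau> x mod k + j) mod k" by (simp add: mod_simps)
    then show ?thesis using \<tau>n[of x j] that by (simp add: S0_def)
  qed
  have "x = y" if "x \<in> S0" "y \<in> S0" "i < k" "j < k" "(\<Phi> ^^ i) x = (\<Phi> ^^ j) y" for x y i j
  proof -
    have "i = j" using \<tau>0[of x i] \<tau>0[of y j] that by simp
    then show ?thesis using that bijn[of i] by (auto simp: S0_def bij_betw_def dest: inj_onD)
  qed
  then show "disjoint_family_on (\<lambda>x. (\<lambda>j. (\<Phi> ^^ j) x) ` {..<k}) S0"
    unfolding disjoint_family_on_def by blast
  show "(\<Union>x\<in>S0. (\<lambda>j. (\<Phi> ^^ j) x) ` {..<k}) = S"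
  proof (intro equalityI subsetI)
    fix y assume "y \<in> (\<Union>x\<in>S0. (\<lambda>j. (\<Phi> ^^ j) x) ` {..<k})"
    then show "y \<in> S" using bijn by (auto simp: S0_def bij_betw_def)
  next
    fix y assume "y \<in> S"
    define j where "j = \<tau> y mod k"
    have j: "j < k" using \<open>k > 0\<close> by (simp add: j_def)
    \<comment> \<open>Going back as many steps as the residue of \<open>y\<close> leads to a
      starting point.\<close>
    have "y \<in> (\<Phi> ^^ j) ` S" using bij_betw_imp_surj_on[OF bijn] \<open>y \<in> S\<close> by simp
    then obtain x where x: "x \<in> S" "(\<Phi> ^^ j) x = y" by blast
    have "(\<tau> x + j) mod k = (0 + j) mod k" using \<tau>n[OF x(1), of j] x(2) by (simp add: j_def)
    then have "\<tau> x mod k = 0" using mod_eq_dvd_iff_nat[of j "\<tau> x + j" k] by simp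
    then show "y \<in> (\<Union>x\<in>S0. (\<lambda>j. (\<Phi> ^^ j) x) ` {..<k})"
      using x j by (auto simp: S0_def)
  qed
qed

text \<open>The lists alternate until \<open>xs\<close> is exhausted, so two entries of
  \<open>xs\<close> are never neighbours.\<close>

lemma successively_splice:
  assumes "length xs \<le> length ys + 1" "\<forall>y\<in>set ys. Q y"
  shows "successively (\<lambda>a b. Q a \<or> Q b) (splice xs ys)"
proof -
  have *: "successively (\<lambda>a b. Q a \<or> Q b) (y # zs)"
    if "Q y" "successively (\<lambda>a b. Q a \<or> Q b) zs" for y zs
    using that by (cases zs) auto
  show ?thesis
    using assms
  proof (induction xs arbitrary: ys)
    case Nil
    then show ?case by (induction ys) (auto intro!: *)
  next
    case (Cons x xs)
    then show ?case by (cases ys) (auto intro!: *)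
  qed
qed

lemma mod_clock_arith:
  fixes X Y k c d e :: nat
  assumes "X mod k = Y mod k"
  shows "(c * (X + d) + e) mod k = (c * (Y + d) + e) mod k"
  using assms by (intro mod_add_cong mod_mult_cong refl)

lemma add_mod_cancel_less:
  fixes i j c d :: nat
  assumes "i < c" "j < c" "(d + i) mod c = (d + j) mod c"
  shows "i = j"
proof -
  have *: "i = j" if "i \<le> j" "j < c" "(d + j) mod c = (d + i) mod c" for i j
  proof -
    have "c dvd j - i" using that mod_eq_dvd_iff_nat[of "d + i" "d + j" c] by simp
    then show ?thesis using that by (auto dest: dvd_imp_le)
  qed
  show ?thesis using *[of i j] *[of j i] assms by (cases "i \<le> j") auto
qed

text \<open>Applying \<open>rho s 0\<close> and then rotations in planes beyond \<open>s\<close> cyclically traverses the given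
  arcs; \<open>clock s\<close> yields a position modulo \<open>k\<close> along this traversal at which to cut it. A
  segment cannot close up: it either changes the clock or uses some plane exactly once.\<close>

lemma cyclic_decomposition:
  assumes bij: "\<And>i. i < t \<Longrightarrow> bij_betw (rho s i) U U" and "s < t" "0 < c" "s + c \<le> t"
    and k: "0 < k" "k dvd 4 ^ Suc s" "k < 4 ^ Suc s"
  shows "\<exists>P. arc_decomposition ((\<lambda>(x, i). (x, rho s i x)) ` (U \<times> insert 0 {s<..<s + c})) k P"
proof -
  \<comment> \<open>Lists the letters of one round: first 0, then \<open>s + 1\<close> up to
    \<open>s + c - 1\<close>.\<close>
  define idx where "idx d = (if d = 0 then 0 else s + d)" for d :: nat
  define word where "word d = map (\<lambda>j. idx ((d + j) mod c))" for d
  \<comment> \<open>A state is a vertex with the phase of the letter to be applied next, hence an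
    arc; \<Phi> moves to the following arc.\<close>
  define \<Phi> where "\<Phi> = (\<lambda>(x, d). (rho s (idx d) x, (d + 1) mod c))"
  \<comment> \<open>Modulo \<open>k\<close> this is \<open>c\<close> times the clock at the start of
    the round, plus the phase. Once the phase is nonzero, letter 0 has already advanced the clock,
    and \<open>k - 1\<close> stands for the correction by -1.\<close>
  define \<tau> where "\<tau> = (\<lambda>(x, d). c * (clock s x + (if d = 0 then 0 else k - 1)) + d)"
  define S where "S = U \<times> {..<c}"
  define S0 where "S0 = {x \<in> S. \<tau> x mod k = 0}"
  define seg where "seg x = (\<lambda>j. (\<Phi> ^^ j) x) ` {..<k}" for x
  define e where "e = (\<lambda>(x, d). (x, rho s (idx d) x))"
  have idx_less: "idx d < t" if "d < c" for d
    using that assms(2,4) by (auto simp: idx_def)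
  have idx_large: "s < idx d" if "d \<noteq> 0" for d
    using that by (auto simp: idx_def)
  have inj_idx: "inj_on idx A" for A
    by (auto simp: inj_on_def idx_def split: if_splits)
  have idx_image: "idx ` {..<c} = insert 0 {s<..<s + c}"
  proof -
    have "idx ` {..<c} = insert 0 (idx ` {0<..<c})"
      using \<open>0 < c\<close> by (auto simp: idx_def image_iff)
    moreover have "idx ` {0<..<c} = {s<..<s + c}"
    proof -
      have "idx ` {0<..<c} = (\<lambda>d. d + s) ` {0<..<c}" by (auto simp: idx_def image_iff)
      also have "\<dots> = {s<..<s + c}"
      proof (intro equalityI subsetI)
        fix i assume "i \<in> {s<..<s + c}"
        then show "i \<in> (\<lambda>d. d + s) ` {0<..<c}" by (intro image_eqI[of _ _ "i - s"]) auto
      qed auto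
      finally show ?thesis .
    qed
    ultimately show ?thesis by simp
  qed
  have S_bij: "bij_betw \<Phi> S S"
  proof -
    have rot: "bij_betw (\<lambda>d. (d + 1) mod c) {..<c} {..<c}"
    proof -
      have "inj_on (\<lambda>d. (d + 1) mod c) {..<c}"
        by (auto simp: inj_on_def mod_Suc split: if_splits)
      moreover have "(\<lambda>d. (d + 1) mod c) ` {..<c} \<subseteq> {..<c}" using \<open>0 < c\<close> by auto
      ultimately show ?thesis by (simp add: bij_betw_def endo_inj_surj)
    qed
    have "inj_on \<Phi> S"
    proof (rule inj_onI, clarify)
      fix x d1 y d2
      assume *: "(x, d1) \<in> S" "(y, d2) \<in> S" "\<Phi> (x, d1) = \<Phi> (y, d2)"
      then have "d1 = d2"
        using rot by (auto simp: S_def \<Phi>_def bij_betw_def dest: inj_onD)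
      then show "x = y \<and> d1 = d2"
        using * bij[OF idx_less[of d1]] by (auto simp: S_def \<Phi>_def bij_betw_def dest: inj_onD)
    qed
    moreover have "\<Phi> ` S = S"
    proof (intro equalityI subsetI)
      fix z assume "z \<in> \<Phi> ` S"
      then show "z \<in> S"
        using bij idx_less \<open>0 < c\<close> by (auto simp: S_def \<Phi>_def bij_betw_def)
    next
      fix z assume "z \<in> S"
      then obtain y d' where z: "z = (y, d')" "y \<in> U" "d' < c" by (auto simp: S_def)
      then obtain d where d: "d < c" "(d + 1) mod c = d'"
        using rot unfolding bij_betw_def by (metis (no_types, lifting) image_iff lessThan_iff)
      have "y \<in> rho s (idx d) ` U"
        using bij_betw_imp_surj_on[OF bij[OF idx_less[OF d(1)]]] z(2) by simp
      then obtain x where "x \<in> U" "rho s (idx d) x = y" by blast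
      then show "z \<in> \<Phi> ` S"
        using d z(1) by (auto simp: S_def \<Phi>_def image_iff intro!: bexI[of _ "(x, d)"])
    qed
    ultimately show ?thesis by (simp add: bij_betw_def)
  qed
  have S_clock: "\<tau> (\<Phi> z) mod k = (\<tau> z + 1) mod k" if zS: "z \<in> S" for z
  proof -
    obtain x d where z: "z = (x, d)" "d < c" using zS by (auto simp: S_def)
    have c0: "clock s (rho s 0 x) mod k = (clock s x + 1) mod k"
      unfolding clock_rho_0 by (rule mod_mod_cancel[OF k(2)])
    have large: "clock s (rho s (idx d) x) = clock s x" if "d \<noteq> 0"
      using idx_large[OF that] by (simp add: rho_large clock_rot)
    \<comment> \<open>The correction enters when the phase leaves 0 and drops out when it returns to
      0; either change costs a multiple \<open>c * k\<close>. With one letter the phase is always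
      0.\<close>
    consider "d = 0" "c = 1" | "d = 0" "c > 1" | "d \<noteq> 0" "d + 1 < c" | "d \<noteq> 0" "d + 1 = c"
      using z(2) \<open>0 < c\<close> by linarith
    then show ?thesis
    proof cases
      case 1
      then show ?thesis using c0 by (simp add: z \<Phi>_def \<tau>_def idx_def)
    next
      case 2
      then have "\<tau> (\<Phi> z) mod k = (c * (clock s (rho s 0 x) + (k - 1)) + 1) mod k"
        by (simp add: z \<Phi>_def \<tau>_def idx_def)
      also have "\<dots> = (c * (clock s x + 1 + (k - 1)) + 1) mod k"
        using c0 by (rule mod_clock_arith)
      also have "\<dots> = (c * clock s x + 1 + c * k) mod k"
        using k(1) by (simp add: algebra_simps)
      finally show ?thesis using 2 by (simp add: z \<tau>_def)
    next
      case 3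
      then show ?thesis by (simp add: z \<Phi>_def \<tau>_def large)
    next
      case 4
      obtain k' where k': "k = Suc k'" using k(1) by (cases k) auto
      have "\<tau> z + 1 = c * (clock s x + k') + (d + 1)"
        by (simp add: z \<tau>_def k' 4(1))
      also have "\<dots> = c * clock s x + c * k"
        unfolding 4(2) k' by (simp add: algebra_simps)
      finally have "\<tau> z + 1 = c * clock s x + c * k" .
      then show ?thesis using 4 by (simp add: z \<Phi>_def \<tau>_def large)
    qed
  qed
  have steps_word: "steps (rho s) x (word d [0..<m]) =
      (\<lambda>(y, d). (y, idx d)) ` (\<lambda>j. (\<Phi> ^^ j) (x, d)) ` {..<m}" if "d < c" for x d m
    using that
  proof (induction m arbitrary: x d)
    case (Suc m)
    have *: "(d + 1) mod c < c" using \<open>0 < c\<close> by simp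
    have "word d [0..<Suc m] = idx d # word ((d + 1) mod c) [0..<m]"
      using Suc.prems by (simp add: word_def upt_conv_Cons map_Suc_upt[symmetric] mod_simps del: upt_Suc)
    moreover have "(\<lambda>j. (\<Phi> ^^ j) (x, d)) ` {..<Suc m} =
        insert (x, d) ((\<lambda>j. (\<Phi> ^^ j) (\<Phi> (x, d))) ` {..<m})"
      by (simp add: lessThan_Suc_eq_insert_0 image_image funpow_swap1)
    moreover have "\<Phi> (x, d) = (rho s (idx d) x, (d + 1) mod c)" by (simp add: \<Phi>_def)
    ultimately show ?case using Suc.IH[OF *, of "rho s (idx d) x"] by simp
  qed (simp add: word_def)
  have no_return: "fold (rho s) (word d [0..<l]) y \<noteq> y" if "0 < l" "l \<le> k" for d l y
  proof (cases "0 \<in> set (word d [0..<l])")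
    case True
    let ?n = "count_list (word d [0..<l]) 0"
    have "?n \<noteq> 0" using True by (simp add: count_list_0_iff)
    moreover have "?n < 4 ^ Suc s"
      \<comment> \<open>Letter 0 occurs at most \<open>k\<close> times, too few for the clock to
        make a full round.\<close>
      using count_le_length[of "word d [0..<l]" 0] that k(3) by (simp add: word_def)
    ultimately have "(clock s y + ?n) mod 4 ^ Suc s \<noteq> clock s y"
      using add_mod_cancel_less[of ?n "4 ^ Suc s" 0 "clock s y"] clock_less[of s y]
      by (auto simp del: power_Suc)
    moreover have "set (word d [0..<l]) \<subseteq> insert 0 {s<..}"
      by (auto simp: word_def idx_def)
    ultimately show ?thesis using clock_fold_rho by metis
  next
    case False
    then have nz: "(d + j) mod c \<noteq> 0" if "j < l" for j
      using that by (auto simp: word_def idx_def image_iff)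
    have "l < c"
    proof (rule ccontr)
      assume "\<not> l < c"
      \<comment> \<open>The offset from phase \<open>d\<close> to the next phase 0, which a block of
        length at least \<open>c\<close> would contain.\<close>
      moreover have "(c - d mod c) mod c < c" using \<open>0 < c\<close> by simp
      ultimately have "(d + (c - d mod c) mod c) mod c \<noteq> 0" by (intro nz) simp
      moreover have "(d + (c - d mod c) mod c) mod c = (d mod c + (c - d mod c)) mod c"
        by (simp add: mod_simps)
      moreover have "d mod c + (c - d mod c) = c" using \<open>0 < c\<close> by (simp add: less_imp_le)
      ultimately show False by simp
    qed
    have "i = j" if "i < l" "j < l" "(d + i) mod c = (d + j) mod c" for i j
      using that \<open>l < c\<close> by (intro add_mod_cancel_less[of i c j d]) auto
    then have "inj_on (\<lambda>j. idx ((d + j) mod c)) {..<l}"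
      using inj_idx[of UNIV] by (auto simp: inj_on_def)
    then have "distinct (word d [0..<l])" by (simp add: word_def distinct_map lessThan_atLeast0)
    moreover have "idx (d mod c) \<in> set (word d [0..<l])"
      using \<open>0 < l\<close> by (force simp: word_def)
    moreover have "s < idx (d mod c)" using nz[OF \<open>0 < l\<close>] by (intro idx_large) simp
    ultimately show ?thesis by (intro fold_rho_neq_once count_list_distinct)
  qed
  have distinct: "distinct (trace (rho s) x (word d [0..<k]))" for x d
  proof (rule distinct_trace)
    fix u v w y assume *: "word d [0..<k] = u @ v @ w" "v \<noteq> []"
    let ?a = "length u" and ?l = "length v"
    have len: "k = ?a + ?l + length w" using arg_cong[OF *(1), of length] by (simp add: word_def)
    have "v = take ?l (drop ?a (word d [0..<k]))" using * by simp
    also have "\<dots> = word d [?a..<?a + ?l]"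
      using len by (simp add: word_def drop_map take_map)
    \<comment> \<open>A block of the cyclic word is again a cyclic word with a shifted
      start.\<close>
    also have "\<dots> = word (d + ?a) [0..<?l]"
      by (rule nth_equalityI) (simp_all add: word_def add_ac)
    finally show "fold (rho s) v y \<noteq> y" using no_return[of ?l "d + ?a" y] * len by simp
  qed
  have arcs: "arcs (trace (rho s) (fst z) (word (snd z) [0..<k])) = e ` seg z" if "z \<in> S" for z
    using that steps_word[of "snd z" "fst z" k]
    by (auto simp: arcs_trace S_def e_def seg_def image_image case_prod_unfold)
  note seg = orbit_segments[of \<Phi> S \<tau> k, OF S_bij S_clock k(1), folded S0_def seg_def]
  \<comment> \<open>A state is recovered from its arc, so disjoint orbit segments yield disjoint
    sets of arcs.\<close>
  have inj: "inj_on e S"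
    using rho_inject[OF idx_less idx_less \<open>s < t\<close>] inj_idx[of UNIV]
    by (auto simp: inj_on_def e_def S_def)
  have S0: "S0 \<subseteq> S" by (auto simp: S0_def)
  have "arc_decomposition (e ` S) k ((\<lambda>z. trace (rho s) (fst z) (word (snd z) [0..<k])) ` S0)"
  proof (rule arc_decomposition_image)
    show "disjoint_family_on (\<lambda>z. arcs (trace (rho s) (fst z) (word (snd z) [0..<k]))) S0"
      unfolding disjoint_family_on_def
    proof (intro ballI impI)
      fix z z' assume *: "z \<in> S0" "z' \<in> S0" "z \<noteq> z'"
      then have "seg z \<inter> seg z' = {}" using seg(1) by (auto simp: disjoint_family_on_def)
      moreover have "seg z \<subseteq> S" "seg z' \<subseteq> S" using seg(2) * by auto
      ultimately have "e ` seg z \<inter> e ` seg z' = {}"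
        using inj_on_image_Int[OF inj] by (metis image_empty)
      moreover have "z \<in> S" "z' \<in> S" using * S0 by auto
      ultimately show "arcs (trace (rho s) (fst z) (word (snd z) [0..<k]))
          \<inter> arcs (trace (rho s) (fst z') (word (snd z') [0..<k])) = {}"
        by (simp only: arcs)
    qed
    show "(\<Union>z\<in>S0. arcs (trace (rho s) (fst z) (word (snd z) [0..<k]))) = e ` S"
    proof -
      have "(\<Union>z\<in>S0. arcs (trace (rho s) (fst z) (word (snd z) [0..<k]))) = (\<Union>z\<in>S0. e ` seg z)"
        using S0 by (intro SUP_cong refl arcs) auto
      then show ?thesis by (simp only: image_UN[symmetric] seg(2))
    qed
  qed (simp add: distinct, simp add: word_def)
  moreover have "e ` S = (\<lambda>(x, i). (x, rho s i x)) ` (U \<times> idx ` {..<c})"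
    unfolding S_def e_def by force
  ultimately show ?thesis unfolding idx_image by metis
qed

lemma two_times_le_power: "2 * s \<le> (2 :: nat) ^ s"
proof (induction s)
  case (Suc s)
  then show ?case by (cases s) auto
qed simp

text \<open>Splits the permutations of one layer: \<open>ws\<close> holds the \<open>l\<close> of
  them used by paths that cross between the layers, while the arcs of the others form
  \<open>B\<close> and are cut into paths inside the layer. The number \<open>2 ^ r\<close> is half
  the path length.\<close>

lemma layer_decomposition:
  assumes inj: "\<And>p. p < t \<Longrightarrow> inj_on (rot p) U" and im: "\<And>p. p < t \<Longrightarrow> rot p ` U \<subseteq> U"
    and "finite U" and "2 ^ r \<le> l + 1" "2 ^ r \<le> t" "l \<le> t"
  shows "\<exists>s ws B P. s < t \<and> set ws \<subseteq> {..<t} \<and> distinct ws \<and> length ws = l \<and>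
    (\<forall>x. distinct (trace (rho s) x ws)) \<and> arc_decomposition B (2 ^ Suc r) P \<and>
    B \<inter> (\<lambda>(x, i). (x, rho s i x)) ` (U \<times> set ws) = {} \<and>
    B \<union> (\<lambda>(x, i). (x, rho s i x)) ` (U \<times> set ws) = (\<lambda>(x, p). (x, rot p x)) ` (U \<times> {..<t})"
proof (cases "l = t")
  case True
  \<comment> \<open>Nothing is left for the cyclic part, so plain rotations suffice; at stage 0 only
    the letter 0 fails to lie beyond the stage.\<close>
  let ?ws = "[0..<t]"
  have "0 < t" using assms(5) by (cases t) auto
  moreover have "distinct (trace (rho 0) x ?ws)" for x
    by (rule distinct_trace_rho) (auto simp: successively_conv_nth)
  moreover have "arc_decomposition {} (2 ^ Suc r) {}"
    by (simp add: arc_decomposition_def disjoint_family_on_def)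
  ultimately show ?thesis
    using True by (intro exI[of _ 0] exI[of _ ?ws] exI[of _ "{}"]) (auto simp: lessThan_atLeast0)
next
  case False
  define c where "c = t - l"
  have c: "0 < c" "t = l + c" using False assms(6) by (auto simp: c_def)
  have "r < 2 ^ r" by (rule less_exp)
  then have r: "r \<le> l" "r < t" using assms(4,5) by linarith+
  \<comment> \<open>The mixed letters \<open>1\<close> to \<open>r\<close> are interleaved with the
    last \<open>l - r\<close> plain ones. Letter 0 and the \<open>c - 1\<close> plain letters after
    \<open>r\<close> remain for the cyclic part.\<close>
  define xs where "xs = [1..<Suc r]"
  define ys where "ys = [r + c..<t]"
  define ws where "ws = splice xs ys"
  have len: "length xs = r" "length ys = l - r" using r c by (auto simp: xs_def ys_def)
  have mset: "mset ws = mset xs + mset ys"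
    unfolding ws_def by (induction xs ys rule: splice.induct) auto
  then have set: "set ws = set xs \<union> set ys" by (metis set_mset_mset set_mset_union)
  have "distinct (xs @ ys)" using c by (auto simp: xs_def ys_def)
  then have dist: "distinct ws" using mset by (metis mset_append mset_eq_imp_distinct_iff)
  \<comment> \<open>There are enough plain letters to separate the mixed ones:
    \<open>2 * r \<le> 2 ^ r \<le> l + 1\<close>.\<close>
  have "successively (\<lambda>i j. r < i \<or> r < j) ws"
    unfolding ws_def
    by (rule successively_splice) (use two_times_le_power[of r] assms(4) r c in \<open>auto simp: len ys_def\<close>)
  then have trace: "distinct (trace (rho r) x ws)" for x by (rule distinct_trace_rho[OF dist])
  have bij: "bij_betw (rho r i) U U" if "i < t" for i
    using bij_betw_rho[OF inj im \<open>finite U\<close> r(2) that] .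
  have "(2 :: nat) ^ Suc r dvd 4 ^ Suc r" "(2 :: nat) ^ Suc r < 4 ^ Suc r"
    by (simp_all add: power_strict_mono dvd_power_same del: power_Suc)
  then obtain P where P: "arc_decomposition
      ((\<lambda>(x, i). (x, rho r i x)) ` (U \<times> insert 0 {r<..<r + c})) (2 ^ Suc r) P"
    using cyclic_decomposition[OF bij r(2) c(1), of "2 ^ Suc r"] r c by auto
  have part: "insert 0 {r<..<r + c} \<inter> set ws = {}" "insert 0 {r<..<r + c} \<union> set ws = {..<t}"
    using r c by (auto simp: set xs_def ys_def)
  have inj: "inj_on (\<lambda>(x, i). (x, rho r i x)) (U \<times> {..<t})"
    using rho_inject[OF _ _ r(2)] by (auto simp: inj_on_def)
  have "(\<lambda>(x, i). (x, rho r i x)) ` (U \<times> insert 0 {r<..<r + c})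
      \<inter> (\<lambda>(x, i). (x, rho r i x)) ` (U \<times> set ws) = {}"
    using part by (subst inj_on_image_Int[OF inj, symmetric]) auto
  moreover have "(\<lambda>(x, i). (x, rho r i x)) ` (U \<times> insert 0 {r<..<r + c})
      \<union> (\<lambda>(x, i). (x, rho r i x)) ` (U \<times> set ws) = (\<lambda>(x, p). (x, rot p x)) ` (U \<times> {..<t})"
  proof -
    have "(\<lambda>(x, i). (x, rho r i x)) ` (U \<times> {..<t}) = (\<Union>x\<in>U. Pair x ` (\<lambda>i. rho r i x) ` {..<t})"
      by auto
    also have "\<dots> = (\<lambda>(x, p). (x, rot p x)) ` (U \<times> {..<t})"
      unfolding rho_image[OF r(2)] by auto
    finally show ?thesis by (simp only: image_Un[symmetric] Sigma_Un_distrib2[symmetric] part)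
  qed
  moreover have "length ws = l" using len r by (simp add: ws_def)
  moreover have "set ws \<subseteq> {..<t}" using part by blast
  ultimately show ?thesis
    using r(2) dist trace P by (intro exI[of _ r] exI[of _ ws] exI conjI allI)
qed

section \<open>The hypercube\<close>

lemma flip_in_verts: "x \<in> hypercube_verts n \<Longrightarrow> j < n \<Longrightarrow> flip j x \<in> hypercube_verts n"
  by (auto simp: hypercube_verts_def flip_def PiE_iff extensional_def)

lemma flip_flip: "x \<in> hypercube_verts n \<Longrightarrow> j < n \<Longrightarrow> flip j (flip j x) = x"
  by (auto simp: hypercube_verts_def flip_def PiE_iff fun_eq_iff)

lemma flip_same [simp]: "flip j x j = (if x j = 0 then 1 else 0)"
  and flip_other: "i \<noteq> j \<Longrightarrow> flip j x i = x i"
  by (simp_all add: flip_def)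

lemma finite_hypercube_verts: "finite (hypercube_verts n)"
  unfolding hypercube_verts_def by (intro finite_PiE) auto

text \<open>On 0-1 vectors the distance counts the coordinates that differ; outside the index range
  both functions are undefined alike.\<close>

lemma l1_dist_eq_1_iff:
  assumes "x \<in> hypercube_verts n" "y \<in> hypercube_verts n"
  shows "l1_dist n x y = 1 \<longleftrightarrow> (\<exists>j<n. y = flip j x)"
proof -
  define D where "D = {i \<in> {..<n}. x i \<noteq> y i}"
  have bits: "x i \<in> {0, 1}" "y i \<in> {0, 1}" if "i < n" for i
    using assms that by (auto simp: hypercube_verts_def PiE_iff)
  have "l1_dist n x y = (\<Sum>i<n. if x i \<noteq> y i then 1 else 0)"
    unfolding l1_dist_def by (rule sum.cong) (use bits in fastforce)+
  also have "\<dots> = int (card D)"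
    by (simp add: D_def sum.If_cases Int_def)
  finally have "l1_dist n x y = 1 \<longleftrightarrow> card D = 1" by simp
  also have "\<dots> \<longleftrightarrow> (\<exists>j<n. y = flip j x)"
  proof
    assume "card D = 1"
    then obtain j where D: "D = {j}" by (auto simp: card_1_singleton_iff)
    have "y i = flip j x i" for i
    proof (cases "i < n")
      case True
      have "i \<in> D \<longleftrightarrow> i = j" using D by simp
      then show ?thesis using True bits[OF True] by (auto simp: D_def flip_def)
    next
      case False
      moreover have "j < n" using D by (auto simp: D_def)
      ultimately show ?thesis
        using assms by (auto simp: hypercube_verts_def flip_def PiE_iff extensional_def)
    qed
    then show "\<exists>j<n. y = flip j x" using D by (auto simp: D_def)
  next
    assume "\<exists>j<n. y = flip j x"
    then obtain j where "j < n" "y = flip j x" by blast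
    then have "D = {j}" by (auto simp: D_def flip_def)
    then show "card D = 1" by simp
  qed
  finally show ?thesis .
qed

lemma hypercube_edges_flip:
  "hypercube_edges n = (\<lambda>(x, j). {x, flip j x}) ` (hypercube_verts n \<times> {..<n})"
  unfolding hypercube_edges_def using flip_in_verts by (fastforce simp: l1_dist_eq_1_iff)

section \<open>The two layers and the orientation of the edges\<close>

definition layer :: "nat \<Rightarrow> int \<Rightarrow> (nat \<Rightarrow> int) set" where
  "layer t b = {x \<in> hypercube_verts (2 * t + 1). x (2 * t) = b}"

definition layer_arcs :: "nat \<Rightarrow> int \<Rightarrow> ((nat \<Rightarrow> int) \<times> (nat \<Rightarrow> int)) set" where
  "layer_arcs t b = (\<lambda>(x, p). (x, rot p x)) ` (layer t b \<times> {..<t})"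

definition rungs :: "nat \<Rightarrow> ((nat \<Rightarrow> int) \<times> (nat \<Rightarrow> int)) set" where
  "rungs t = (\<lambda>x. (x, flip (2 * t) x)) ` layer t 0"

lemma finite_layer: "finite (layer t b)"
  unfolding layer_def using finite_hypercube_verts by auto

lemma layer_disjoint: "layer t 0 \<inter> layer t 1 = {}"
  by (auto simp: layer_def)

lemma rot_layer:
  assumes "p < t"
  shows "rot p ` layer t b \<subseteq> layer t b"
  using assms by (auto simp: layer_def rot_def flip_other intro!: flip_in_verts)

text \<open>Equal images have equal positions in plane \<open>p\<close>, so both vertices had the
  same coordinate flipped, and a flip is an involution.\<close>

lemma inj_on_rot_layer:
  assumes "p < t"
  shows "inj_on (rot p) (layer t b)"
proof (rule inj_onI)
  fix x y assume *: "x \<in> layer t b" "y \<in> layer t b" "rot p x = rot p y"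
  have "(angle p x + 1) mod 4 = (angle p y + 1) mod 4"
    using angle_rot[of p p x] angle_rot[of p p y] *(3) by simp
  then have "angle p x = angle p y"
    using angle_less[of p x] angle_less[of p y] by (simp add: mod_Suc split: if_splits)
  then have "(x (2 * p) = 0) = (x (2 * p + 1) = 0) \<longleftrightarrow> (y (2 * p) = 0) = (y (2 * p + 1) = 0)"
    by (auto simp: angle_def split: if_splits)
  then obtain j where "rot p x = flip j x" "rot p y = flip j y" "j < 2 * t + 1"
    using assms by (cases "(x (2 * p) = 0) = (x (2 * p + 1) = 0)") (auto simp: rot_def)
  moreover have "x \<in> hypercube_verts (2 * t + 1)" "y \<in> hypercube_verts (2 * t + 1)"
    using * by (auto simp: layer_def)
  ultimately show "x = y" using *(3) flip_flip by metis
qed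

lemma flip_bij_layers: "bij_betw (flip (2 * t)) (layer t 0) (layer t 1)"
  by (rule bij_betw_byWitness[where f' = "flip (2 * t)"])
    (auto simp: layer_def intro!: flip_in_verts flip_flip)

lemma layer_arcs_subset: "layer_arcs t b \<subseteq> layer t b \<times> layer t b"
  unfolding layer_arcs_def using rot_layer by fastforce

lemma rungs_subset: "rungs t \<subseteq> layer t 0 \<times> layer t 1"
  unfolding rungs_def using flip_bij_layers by (auto simp: bij_betw_def)

lemma verts_layers: "hypercube_verts (2 * t + 1) = layer t 0 \<union> layer t 1"
proof -
  have "x (2 * t) = 0 \<or> x (2 * t) = 1" if "x \<in> hypercube_verts (2 * t + 1)" for x
    using PiE_mem[OF that[unfolded hypercube_verts_def], of "2 * t"] by simp
  then show ?thesis by (auto simp: layer_def)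
qed

lemma hypercube_edges_arcs:
  "(\<lambda>(y, z). {y, z}) ` (layer_arcs t 0 \<union> layer_arcs t 1 \<union> rungs t) = hypercube_edges (2 * t + 1)"
    (is "?e ` ?A = ?E")
proof (intro equalityI subsetI)
  have A: "?A = (\<lambda>(x, p). (x, rot p x)) ` (hypercube_verts (2 * t + 1) \<times> {..<t}) \<union> rungs t"
    unfolding layer_arcs_def verts_layers by auto
  fix e
  {
    assume "e \<in> ?e ` ?A"
    then consider x p where "x \<in> hypercube_verts (2 * t + 1)" "p < t" "e = {x, rot p x}"
      | x where "x \<in> hypercube_verts (2 * t + 1)" "e = {x, flip (2 * t) x}"
      unfolding A by (auto simp: rungs_def layer_def)
    then show "e \<in> ?E"
    proof cases
      case 1
      moreover obtain j where "rot p x = flip j x" "j < 2 * t + 1"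
        using \<open>p < t\<close> by (cases "(x (2 * p) = 0) = (x (2 * p + 1) = 0)") (auto simp: rot_def)
      ultimately show ?thesis by (auto simp: hypercube_edges_flip image_iff intro!: bexI[of _ "(x, j)"])
    next
      case 2
      then show ?thesis by (auto simp: hypercube_edges_flip image_iff intro!: bexI[of _ "(x, 2 * t)"])
    qed
  next
    assume "e \<in> ?E"
    then obtain x j where e: "x \<in> hypercube_verts (2 * t + 1)" "j < 2 * t + 1" "e = {x, flip j x}"
      by (auto simp: hypercube_edges_flip)
    define y where "y = flip j x"
    have y: "y \<in> hypercube_verts (2 * t + 1)" "flip j y = x" "e = {y, flip j y}"
      using e flip_in_verts flip_flip by (auto simp: y_def)
    show "e \<in> ?e ` ?A"
    proof (cases "j = 2 * t")
      case True
      have "x \<in> layer t 0 \<or> y \<in> layer t 0"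
        using e(1) y(1) True verts_layers[of t] by (auto simp: y_def layer_def)
      then show ?thesis
        using e(3) y(3) True by (auto simp: rungs_def image_iff insert_commute)
    next
      case False
      define p where "p = j div 2"
      have p: "p < t" "j = 2 * p \<or> j = 2 * p + 1" using False e(2) by (auto simp: p_def)
      \<comment> \<open>Flipping \<open>j\<close> toggles whether the two coordinates of plane
        \<open>p\<close> agree, so \<open>rot p\<close> flips \<open>j\<close> at one end of the
        edge and the other coordinate at the other end.\<close>
      have "rot p x = flip j x \<or> rot p y = flip j y"
        using p(2) by (auto simp: rot_def y_def flip_other)
      moreover have "(z, rot p z) \<in> ?A" if "z \<in> hypercube_verts (2 * t + 1)" for z
        unfolding A using that p(1) by auto
      ultimately have "(x, flip j x) \<in> ?A \<or> (y, flip j y) \<in> ?A"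
        using e(1) y(1) by metis
      then show ?thesis using e(3) y(3) by (metis (no_types, lifting) case_prod_conv image_eqI)
    qed
  }
qed

text \<open>No arc occurs together with its reverse: rungs only lead upwards, and two rotations
  never cancel.\<close>

lemma inj_on_edge_arcs:
  "inj_on (\<lambda>(y, z). {y, z}) (layer_arcs t 0 \<union> layer_arcs t 1 \<union> rungs t)" (is "inj_on ?e ?A")
proof -
  have "(z, y) \<notin> ?A" if yz: "(y, z) \<in> ?A" for y z
  proof
    assume zy: "(z, y) \<in> ?A"
    have sub: "layer_arcs t b \<subseteq> layer t b \<times> layer t b" "rungs t \<subseteq> layer t 0 \<times> layer t 1" for b
      by (rule layer_arcs_subset rungs_subset)+
    have "(y, z) \<notin> rungs t" "(z, y) \<notin> rungs t"
      using yz zy sub layer_disjoint[of t] by blast+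
    then obtain p q where "z = rot p y" "y = rot q z"
      using yz zy by (auto simp: layer_arcs_def)
    then show False using rot_rot_neq by metis
  qed
  then have *: "\<not> ((y, z) \<in> ?A \<and> (z, y) \<in> ?A)" for y z
    by blast
  show ?thesis
  proof (rule inj_onI)
    fix a b assume ab: "a \<in> ?A" "b \<in> ?A" "?e a = ?e b"
    obtain y z y' z' where eq: "a = (y, z)" "b = (y', z')" by (metis surj_pair)
    then have "y = y' \<and> z = z' \<or> y = z' \<and> z = y'" using ab(3) by (simp add: doubleton_eq_iff)
    then show "a = b" using ab(1,2) *[of y z] unfolding eq by auto
  qed
qed

section \<open>Assembly of the decomposition\<close>

lemma path_decomposition_hypercube:
  assumes "arc_decomposition (layer_arcs t 0 \<union> layer_arcs t 1 \<union> rungs t) k P" "k \<ge> 1"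
  shows "path_decomposition (hypercube_verts (2 * t + 1)) (hypercube_edges (2 * t + 1)) k P"
  unfolding hypercube_edges_arcs[symmetric]
proof (rule path_decomposition_of_arcs[OF assms _ inj_on_edge_arcs])
  show "layer_arcs t 0 \<union> layer_arcs t 1 \<union> rungs t
      \<subseteq> hypercube_verts (2 * t + 1) \<times> hypercube_verts (2 * t + 1)"
    using layer_arcs_subset[of t 0] layer_arcs_subset[of t 1] rungs_subset[of t]
    unfolding verts_layers by blast
qed

lemma odd_hypercube_decomposition:
  assumes "2 ^ r \<le> t"
  shows "\<exists>P. path_decomposition (hypercube_verts (2 * t + 1)) (hypercube_edges (2 * t + 1)) (2 ^ Suc r) P"
proof -
  let ?D = "\<lambda>s b ws. (\<lambda>(x, i). (x, rho s i x)) ` (layer t b \<times> set ws)"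
  have ex: "\<exists>s ws B P. s < t \<and> set ws \<subseteq> {..<t} \<and> distinct ws \<and> length ws = l \<and>
    (\<forall>x. distinct (trace (rho s) x ws)) \<and> arc_decomposition B (2 ^ Suc r) P \<and>
    B \<inter> ?D s b ws = {} \<and> B \<union> ?D s b ws = layer_arcs t b" if "2 ^ r \<le> l + 1" "l \<le> t" for b l
    unfolding layer_arcs_def
    using layer_decomposition[OF inj_on_rot_layer rot_layer finite_layer that(1) assms that(2)] .
  \<comment> \<open>The lower layer gets one letter less than the upper one, to make room for the
    rung: \<open>(2 ^ r - 1) + 1 + 2 ^ r = 2 ^ Suc r\<close>.\<close>
  have le: "(2 :: nat) ^ r \<le> 2 ^ r - 1 + 1" "2 ^ r - 1 \<le> t" "(2 :: nat) ^ r \<le> 2 ^ r + 1"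
    using assms by simp_all
  obtain s0 ws0 B0 P0 where 0: "s0 < t" "set ws0 \<subseteq> {..<t}" "distinct ws0" "length ws0 = 2 ^ r - 1"
    "\<And>x. distinct (trace (rho s0) x ws0)" "arc_decomposition B0 (2 ^ Suc r) P0"
    "B0 \<inter> ?D s0 0 ws0 = {}" "B0 \<union> ?D s0 0 ws0 = layer_arcs t 0"
    using ex[OF le(1,2), of 0] by (elim exE conjE) (rule that; (assumption | erule spec))
  obtain s1 ws1 B1 P1 where 1: "s1 < t" "set ws1 \<subseteq> {..<t}" "distinct ws1" "length ws1 = 2 ^ r"
    "\<And>x. distinct (trace (rho s1) x ws1)" "arc_decomposition B1 (2 ^ Suc r) P1"
    "B1 \<inter> ?D s1 1 ws1 = {}" "B1 \<union> ?D s1 1 ws1 = layer_arcs t 1"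
    using ex[OF le(3) assms, of 1] by (elim exE conjE) (rule that; (assumption | erule spec))
  have bij: "bij_betw (rho s i) (layer t b) (layer t b)" if "s < t" "i < t" for s i b
    by (rule bij_betw_rho[OF inj_on_rot_layer rot_layer finite_layer that])
  \<comment> \<open>Sends the start of a path to the vertex where it leaves the lower layer. As
    \<open>m\<close> is a bijection, every rung is used exactly once and the upper halves start at
    every upper vertex exactly once.\<close>
  define m where "m = fold (rho s0) ws0"
  have m: "bij_betw m (layer t 0) (layer t 0)"
    unfolding m_def by (rule bij_betw_fold) (use 0 bij in blast)
  define up where "up = flip (2 * t)"
  have up: "bij_betw up (layer t 0) (layer t 1)" unfolding up_def by (rule flip_bij_layers)
  have upm: "bij_betw (up \<circ> m) (layer t 0) (layer t 1)" using bij_betw_trans[OF m up] .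
  define g0 where "g0 x = trace (rho s0) x ws0" for x
  define g1 where "g1 x = trace (rho s1) (up (m x)) ws1" for x
  have arcs_g: "arcs (g0 x @ g1 x) = arcs (g0 x) \<union> {(m x, up (m x))} \<union> arcs (g1 x)" for x
    by (subst arcs_append) (simp_all add: g0_def g1_def m_def)
  have D0: "disjoint_family_on (\<lambda>x. arcs (g0 x)) (layer t 0)"
    "(\<Union>x\<in>layer t 0. arcs (g0 x)) = ?D s0 0 ws0"
    unfolding g0_def by (rule arcs_trace_rho[OF bij[OF 0(1)] 0(1-3)]; assumption)+
  note D1 = arcs_trace_rho[OF bij[OF 1(1)] 1(1-3), of 1]
  have U1: "(\<Union>x\<in>layer t 0. arcs (g1 x)) = ?D s1 1 ws1"
  proof -
    have "(\<Union>x\<in>layer t 0. arcs (g1 x)) = (\<Union>y\<in>(up \<circ> m) ` layer t 0. arcs (trace (rho s1) y ws1))"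
      by (simp add: g1_def)
    also have "\<dots> = ?D s1 1 ws1" by (simp only: bij_betw_imp_surj_on[OF upm] D1(2))
    finally show ?thesis .
  qed
  have UR: "(\<Union>x\<in>layer t 0. {(m x, up (m x))}) = rungs t"
  proof -
    have "(\<Union>x\<in>layer t 0. {(m x, up (m x))}) = (\<lambda>y. (y, up y)) ` m ` layer t 0" by auto
    then show ?thesis using bij_betw_imp_surj_on[OF m] by (simp add: rungs_def up_def)
  qed
  have sub: "?D s0 0 ws0 \<subseteq> layer_arcs t 0" "?D s1 1 ws1 \<subseteq> layer_arcs t 1" using 0(8) 1(8) by auto
  have arcs_disj: "layer_arcs t 0 \<inter> layer_arcs t 1 = {}" "layer_arcs t b \<inter> rungs t = {}" for b
  proof -
    have "rungs t \<inter> layer t c \<times> layer t c = {}" for c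
      using rungs_subset[of t] by (auto simp: layer_def)
    then show "layer_arcs t b \<inter> rungs t = {}" for b using layer_arcs_subset[of t b] by blast
    show "layer_arcs t 0 \<inter> layer_arcs t 1 = {}"
      using layer_arcs_subset[of t 0] layer_arcs_subset[of t 1] layer_disjoint[of t] by blast
  qed
  have part: "arcs (g0 z) \<subseteq> layer_arcs t 0" "(m z, up (m z)) \<in> rungs t"
    "arcs (g1 z) \<subseteq> layer_arcs t 1" if "z \<in> layer t 0" for z
  proof -
    show "arcs (g0 z) \<subseteq> layer_arcs t 0"
      using UN_upper[OF that, of "\<lambda>x. arcs (g0 x)", unfolded D0(2)] sub(1) by (rule subset_trans)
    show "(m z, up (m z)) \<in> rungs t"
      using UN_upper[OF that, of "\<lambda>x. {(m x, up (m x))}", unfolded UR] by simp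
    show "arcs (g1 z) \<subseteq> layer_arcs t 1"
      using UN_upper[OF that, of "\<lambda>x. arcs (g1 x)", unfolded U1] sub(2) by (rule subset_trans)
  qed
  have F: "arc_decomposition (?D s0 0 ws0 \<union> rungs t \<union> ?D s1 1 ws1) (2 ^ Suc r)
      ((\<lambda>x. g0 x @ g1 x) ` layer t 0)"
  proof (rule arc_decomposition_image)
    fix x assume x: "x \<in> layer t 0"
    have "rho s0 i ` layer t 0 \<subseteq> layer t 0" if "i \<in> set ws0" for i
      using bij[OF 0(1), of i] 0(2) that by (auto simp: bij_betw_def)
    then have "set (g0 x) \<subseteq> layer t 0"
      unfolding g0_def using x by (intro set_trace_subset)
    moreover have "rho s1 i ` layer t 1 \<subseteq> layer t 1" if "i \<in> set ws1" for i
      using bij[OF 1(1), of i] 1(2) that by (auto simp: bij_betw_def)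
    then have "set (g1 x) \<subseteq> layer t 1"
      unfolding g1_def using x bij_betwE[OF upm] by (intro set_trace_subset) auto
    \<comment> \<open>The halves lie in different layers, so it is enough that each is free of
      repetitions.\<close>
    ultimately have "set (g0 x) \<inter> set (g1 x) = {}" using layer_disjoint by blast
    then have "distinct (g0 x @ g1 x)" using 0(5) 1(5) by (simp add: g0_def g1_def)
    moreover have "length (g0 x @ g1 x) = 2 ^ Suc r + 1" by (simp add: g0_def g1_def 0(4) 1(4))
    ultimately show "length (g0 x @ g1 x) = 2 ^ Suc r + 1 \<and> distinct (g0 x @ g1 x)" by blast
  next
    show "disjoint_family_on (\<lambda>x. arcs (g0 x @ g1 x)) (layer t 0)"
      unfolding disjoint_family_on_def
    proof (intro ballI impI)
      fix x y assume *: "x \<in> layer t 0" "y \<in> layer t 0" "x \<noteq> y"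
      have "arcs (g0 x) \<inter> arcs (g0 y) = {}"
        using D0(1) * by (simp add: disjoint_family_on_def)
      moreover have "m x \<noteq> m y" using m * by (auto simp: bij_betw_def dest: inj_onD)
      moreover have "arcs (g1 x) \<inter> arcs (g1 y) = {}"
      proof -
        have "up (m x) \<noteq> up (m y)"
          using inj_onD[OF bij_betw_imp_inj_on[OF upm], of x y] * by auto
        moreover have "up (m x) \<in> layer t 1" "up (m y) \<in> layer t 1"
          using bij_betwE[OF upm] * by auto
        ultimately show ?thesis using D1(1) by (simp add: disjoint_family_on_def g1_def)
      qed
      moreover note part[OF *(1)] part[OF *(2)]
      ultimately show "arcs (g0 x @ g1 x) \<inter> arcs (g0 y @ g1 y) = {}"
        unfolding arcs_g using arcs_disj(1) arcs_disj(2)[of 0] arcs_disj(2)[of 1] by auto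
    qed
    show "(\<Union>x\<in>layer t 0. arcs (g0 x @ g1 x)) = ?D s0 0 ws0 \<union> rungs t \<union> ?D s1 1 ws1"
      unfolding arcs_g UN_Un_distrib D0(2) U1 UR ..
  qed
  have B: "B0 \<subseteq> layer_arcs t 0" "B1 \<subseteq> layer_arcs t 1" using 0(8) 1(8) by auto
  have "arc_decomposition (B0 \<union> B1) (2 ^ Suc r) (P0 \<union> P1)"
    using 0(6) 1(6) B arcs_disj by (intro arc_decomposition_Un) auto
  then have "arc_decomposition ((B0 \<union> B1) \<union> (?D s0 0 ws0 \<union> rungs t \<union> ?D s1 1 ws1)) (2 ^ Suc r)
      ((P0 \<union> P1) \<union> (\<lambda>x. g0 x @ g1 x) ` layer t 0)"
    using F
  proof (rule arc_decomposition_Un)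
    have "X \<inter> Y = {}" if "X \<subseteq> X'" "Y \<subseteq> Y'" "X' \<inter> Y' = {}"
      for X X' Y Y' :: "((nat \<Rightarrow> int) \<times> (nat \<Rightarrow> int)) set"
      using that by blast
    note disjI = this
    have "B0 \<inter> rungs t = {}" "B1 \<inter> rungs t = {}"
      using disjI[OF B(1) order_refl] disjI[OF B(2) order_refl] arcs_disj(2) by simp_all
    moreover have "B0 \<inter> ?D s1 1 ws1 = {}" "B1 \<inter> ?D s0 0 ws0 = {}"
      using disjI[OF B(1) sub(2)] disjI[OF B(2) sub(1)] arcs_disj(1) by (simp_all only: Int_commute)
    ultimately show "(B0 \<union> B1) \<inter> (?D s0 0 ws0 \<union> rungs t \<union> ?D s1 1 ws1) = {}"
      using 0(7) 1(7) by (simp only: Int_Un_distrib Int_Un_distrib2 Un_empty)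
  qed
  moreover have "(B0 \<union> B1) \<union> (?D s0 0 ws0 \<union> rungs t \<union> ?D s1 1 ws1) =
      layer_arcs t 0 \<union> layer_arcs t 1 \<union> rungs t"
    unfolding 0(8)[symmetric] 1(8)[symmetric] by (simp only: Un_ac)
  ultimately obtain P where
    "arc_decomposition (layer_arcs t 0 \<union> layer_arcs t 1 \<union> rungs t) (2 ^ Suc r) P"
    by auto
  then have "path_decomposition (hypercube_verts (2 * t + 1)) (hypercube_edges (2 * t + 1)) (2 ^ Suc r) P"
    by (rule path_decomposition_hypercube) simp
  then show ?thesis ..
qed

theorem theorem2p5:
  fixes n r :: nat
  assumes "odd n" and "n > 0" and "2 ^ r < n"
  shows "\<exists>P. path_decomposition (hypercube_verts n) (hypercube_edges n) (2 ^ r) P"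
proof -
  obtain t where n: "n = 2 * t + 1" using \<open>odd n\<close> by (auto elim: oddE)
  show ?thesis
  proof (cases r)
    \<comment> \<open>Length 1 has no halves to distribute over the layers; every arc is a path by
      itself once loops are excluded.\<close>
    case 0
    let ?A = "layer_arcs t 0 \<union> layer_arcs t 1 \<union> rungs t"
    have "(y, y) \<notin> ?A" for y
      using rungs_subset[of t] layer_disjoint[of t]
      by (auto simp: layer_arcs_def) (metis rot_neq)+
    then have "arc_decomposition ?A 1 ((\<lambda>(y, z). [y, z]) ` ?A)"
      by (intro arc_decomposition_image) (auto simp: disjoint_family_on_def)
    then have "path_decomposition (hypercube_verts n) (hypercube_edges n) 1 ((\<lambda>(y, z). [y, z]) ` ?A)"
      unfolding n by (rule path_decomposition_hypercube) simp
    then show ?thesis unfolding 0 power_0 ..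
  next
    case (Suc r')
    then have "2 ^ r' \<le> t" using assms(3) n by simp
    then show ?thesis using odd_hypercube_decomposition[of r' t] n Suc by simp
  qed
qed

end
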